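(* Let $\mu_1,\mu_2,\mu_3,\mu_4$ be four absolutely continuous probability measures on $\mathbb{R}^2$. Then there exist two lines in $\mathbb{R}^2$ that split $\mathbb{R}^2$ into four pieces $C_1,C_2,C_3,C_4$ such that $(C_1,C_2,C_3,C_4)$ is an envy-free partition for $\mu_1,\mu_2,\mu_3,\mu_4$. Moreover, the partition can be found with access to only three of the four measures: given absolutely continuous probability measures $\mu_1,\mu_2,\mu_3$ on $\mathbb{R}^2$, there exist two lines splitting $\mathbb{R}^2$ into four pieces $C_1,\dots,C_4$ such that for every absolutely continuous probability measure $\mu_4$ on $\mathbb{R}^2$, $(C_1,\dots,C_4)$ is an envy-free partition for $\mu_1,\mu_2,\mu_3,\mu_4$.
   Context: A measure on $\mathbb{R}^d$ is called absolutely continuous if it is absolutely continuous with respect to the Lebesgue measure. Write $[n]=\{1,\dots,n\}$. The pieces determined by two lines are the closed regions into which the two lines divide the plane (closures of the connected components of the complement of the union of the lines). A partition $(C_1,\dots,C_n)$ of $\mathbb{R}^d$ is an envy-free partition for measures $\mu_1,\dots,\mu_n$ if there is a permutation $\pi:[n]\to[n]$ such that $\mu_i(C_{\pi(i)})\ge \mu_i(C_{\pi(i')})$ for all $i,i'\in[n]$. *)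

theory Defs
  imports "HOL-Probability.Probability"
begin

definition ac_prob_measure :: "(real ^ 'd) measure \<Rightarrow> bool" where
  "ac_prob_measure \<mu> \<longleftrightarrow>
     sets \<mu> = sets borel \<and> prob_space \<mu> \<and> absolutely_continuous lborel \<mu>"

definition is_line :: "(real ^ 2) set \<Rightarrow> bool" where
  "is_line L \<longleftrightarrow> affine L \<and> aff_dim L = 1"

definition pieces :: "(real ^ 2) set \<Rightarrow> (real ^ 2) set \<Rightarrow> (real ^ 2) set set" where
  "pieces L M = closure ` components (- (L \<union> M))"

(* The labelling C enumerates the pieces without repetition, so there are exactly
   four of them; this excludes coinciding and parallel lines. *)
definition split_by_two_lines ::
  "(real ^ 2) set \<Rightarrow> (real ^ 2) set \<Rightarrow> (nat \<Rightarrow> (real ^ 2) set) \<Rightarrow> bool" where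
  "split_by_two_lines L M C \<longleftrightarrow>
     is_line L \<and> is_line M \<and> bij_betw C {1..4} (pieces L M)"

(* The parts are closed regions, so a partition is a cover whose parts may
   share boundary points but have pairwise disjoint interiors. *)
definition is_partition :: "nat \<Rightarrow> (nat \<Rightarrow> (real ^ 'd) set) \<Rightarrow> bool" where
  "is_partition n C \<longleftrightarrow>
     (\<Union>i\<in>{1..n}. C i) = UNIV \<and>
     (\<forall>i\<in>{1..n}. closed (C i)) \<and>
     (\<forall>i\<in>{1..n}. \<forall>j\<in>{1..n}. i \<noteq> j \<longrightarrow> interior (C i) \<inter> interior (C j) = {})"

definition envy_free_partition ::
  "nat \<Rightarrow> (nat \<Rightarrow> (real ^ 'd) measure) \<Rightarrow> (nat \<Rightarrow> (real ^ 'd) set) \<Rightarrow> bool" where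
  "envy_free_partition n \<mu> C \<longleftrightarrow>
     is_partition n C \<and>
     (\<exists>\<pi>. \<pi> permutes {1..n} \<and>
        (\<forall>i\<in>{1..n}. \<forall>i'\<in>{1..n}. measure (\<mu> i) (C (\<pi> i)) \<ge> measure (\<mu> i) (C (\<pi> i'))))"

end

theory Submission
  imports Defs
begin

text \<open>
Call two lines good for the first three measures if, whichever of the four pieces the fourth
measure takes, the other three pieces can be handed to the first three measures so that each of
them gets a piece that it likes best. Good lines settle both parts of the theorem at once: let
the fourth measure take its favourite piece.

Being good imposes three equations. Suppose each of the three measures spreads one unit of weight
over its favourite pieces. If the total weight on each of the four pieces is \<open>3/4\<close>, then any
\<open>k\<close> of the measures place weight \<open>k\<close>, for which \<open>k\<close> pieces have no room, so their
favourites comprise at least \<open>k + 1\<close> pieces; by Hall's condition a matching survives the removal of any one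
piece (\<open>positive_matching_avoiding_column\<close>). It therefore suffices to find a configuration at
which a continuous map into the three-dimensional simplex hits the centre, and a family of pairs of
lines with three parameters suffices for that.

The family keeps one line \<open>L\<close> horizontal and is indexed by the cube \<open>[-1,1]\<^sup>3\<close>. The first
coordinate moves \<open>L\<close> from height plus infinity to height minus infinity; the other two govern
how the second line \<open>M\<close> splits the upper and the lower half-plane into left and right parts.
On every face of the cube the corresponding pieces are empty (\<open>empty_pieces\<close>): the lines have
moved to infinity, or \<open>M\<close> has become parallel to \<open>L\<close>. The formula is chosen so that neither
line equation degenerates to \<open>0 = 0\<close>, not even in these limits, and since hyperplanes are null
sets the measures of the pieces depend continuously on the parameters
(\<open>continuous_on_measure_sector\<close>). An empty piece receives no weight, so the differences of weights
\<open>top - bottom\<close>, \<open>top left - top right\<close> and \<open>bottom left - bottom right\<close> have the signs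
on opposite faces that the Poincare-Miranda theorem requires, and a common zero is a point where
all four weights are \<open>3/4\<close>.

Favourites do not depend continuously on the parameters, so the weights are put on pieces that are
favourites up to \<open>\<epsilon>\<close>, and compactness of the cube removes the \<open>\<epsilon>\<close>
(\<open>envy_free_for_every_choice\<close>). At the configuration found, every piece is a favourite of some
measure and hence nonempty, which excludes all the limiting configurations: \<open>L\<close> and \<open>M\<close> are
honest lines that cut the plane into four pieces (\<open>sectors_split_by_two_lines\<close>).
\<close>

section \<open>The Poincare-Miranda theorem\<close>

text \<open>
A fixed point of the map that follows \<open>- f\<close> and is then clamped to the box is a zero of
\<open>f\<close>: were \<open>f i\<close> nonzero there, clamping would have to undo the step on the face towards
which \<open>- f i\<close> points, and the sign condition on that face forbids this direction.
\<close>
lemma poincare_miranda: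
  fixes f :: "'n::finite \<Rightarrow> real ^ 'n \<Rightarrow> real"
  assumes le: "\<And>i. a $ i \<le> b $ i"
    and cont: "\<And>i. continuous_on (cbox a b) (f i)"
    and lower: "\<And>x i. x \<in> cbox a b \<Longrightarrow> x $ i = a $ i \<Longrightarrow> f i x \<le> 0"
    and upper: "\<And>x i. x \<in> cbox a b \<Longrightarrow> x $ i = b $ i \<Longrightarrow> 0 \<le> f i x"
  obtains x where "x \<in> cbox a b" "\<And>i. f i x = 0"
proof -
  define g where "g x = (\<chi> i. max (a $ i) (min (b $ i) (x $ i - f i x)))" for x
  have "continuous_on (cbox a b) g"
    unfolding g_def continuous_on_def
    by (intro ballI tendsto_vec_lambda tendsto_intros)
      (use cont in \<open>auto simp: continuous_on_def\<close>)
  moreover have "g \<in> cbox a b \<rightarrow> cbox a b"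
    using le by (auto simp: g_def mem_box_cart)
  moreover have "a \<in> cbox a b"
    using le by (auto simp: mem_box_cart)
  ultimately obtain x where x: "x \<in> cbox a b" and fixp: "g x = x"
    using brouwer[OF compact_cbox convex_box(1), of a b g] by blast
  have "f i x = 0" for i
  proof -
    have fi: "max (a $ i) (min (b $ i) (x $ i - f i x)) = x $ i"
      using arg_cong[OF fixp, of "\<lambda>v. v $ i"] by (simp add: g_def)
    have "a $ i \<le> x $ i" "x $ i \<le> b $ i"
      using x by (auto simp: mem_box_cart)
    with fi show ?thesis
      using lower[OF x, of i] upper[OF x, of i] by (auto simp: max_def min_def split: if_splits)
  qed
  with x show ?thesis by (rule that)
qed

section \<open>Matchings from balanced weights\<close>

lemma atLeast1AtMost_3_4:
  "{1..3} = {1, 2, 3::nat}" "{1..4} = {1, 2, 3, 4::nat}"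
  by auto

text \<open>
Three measures choose among the columns, and the fourth person, who has column \<open>j0\<close>, is row
\<open>4\<close> of the permutation. Without column \<open>j0\<close>, any \<open>k\<close> rows still carry weight at least
\<open>k - 3/4\<close>, which exceeds the \<open>(k - 1) * 3/4\<close> that fits into \<open>k - 1\<close> columns, so Hall's
condition holds. For three rows the marriage theorem is a finite propositional fact.
\<close>
lemma positive_matching_avoiding_column:
  fixes w :: "nat \<Rightarrow> nat \<Rightarrow> real"
  assumes nonneg: "\<And>i j. i \<in> {1..3} \<Longrightarrow> j \<in> {1..4} \<Longrightarrow> 0 \<le> w i j"
    and rows: "\<And>i. i \<in> {1..3} \<Longrightarrow> (\<Sum>j\<in>{1..4}. w i j) = 1"
    and cols: "\<And>j. j \<in> {1..4} \<Longrightarrow> (\<Sum>i\<in>{1..3}. w i j) = 3/4"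
    and j0: "j0 \<in> {1..4}"
  shows "\<exists>\<pi>. \<pi> permutes {1..4} \<and> \<pi> 4 = j0 \<and> (\<forall>i\<in>{1..3}. 0 < w i (\<pi> i))"
proof -
  obtain a b c where abc: "distinct [a, b, c, j0]" "{a, b, c, j0} = {1..4}"
  proof -
    consider "j0 = 1" | "j0 = 2" | "j0 = 3" | "j0 = 4" using j0 by fastforce
    then show thesis
      by cases (rule that[of 2 3 4] that[of 1 3 4] that[of 1 2 4] that[of 1 2 3]; auto)+
  qed
  have mem: "a \<in> {1..4}" "b \<in> {1..4}" "c \<in> {1..4}" using abc by blast+
  have row: "w i a + w i b + w i c + w i j0 = 1" if "i \<in> {1..3}" for i
    using rows[OF that, folded abc(2)] abc(1) by (simp add: algebra_simps)
  have col: "w 1 j + w 2 j + w 3 j = 3/4" if "j \<in> {1..4}" for j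
    using cols[OF that] unfolding atLeast1AtMost_3_4 by simp
  have in3: "1 \<in> {1..3::nat}" "2 \<in> {1..3::nat}" "3 \<in> {1..3::nat}" by auto
  note sums = row[OF in3(1)] row[OF in3(2)] row[OF in3(3)]
    col[OF mem(1)] col[OF mem(2)] col[OF mem(3)] col[OF j0]
  have nn: "0 \<le> w i a" "0 \<le> w i b" "0 \<le> w i c" "0 \<le> w i j0" if "i \<in> {1..3}" for i
    using nonneg that mem j0 by blast+
  note nn3 = nn[OF in3(1)] nn[OF in3(2)] nn[OF in3(3)]
  define p where "p i j \<longleftrightarrow> w i j > 0" for i j
  \<comment> \<open>Hall's condition in contrapositive form: the support of \<open>k\<close> rows is not contained in any
    \<open>k - 1\<close> columns.\<close>
  have one_row: "p 1 a \<or> p 1 b \<or> p 1 c" "p 2 a \<or> p 2 b \<or> p 2 c" "p 3 a \<or> p 3 b \<or> p 3 c"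
    unfolding p_def using sums nn3 by linarith+
  have two_rows:
    "p 1 a \<or> p 1 b \<or> p 2 a \<or> p 2 b" "p 1 a \<or> p 1 c \<or> p 2 a \<or> p 2 c" "p 1 b \<or> p 1 c \<or> p 2 b \<or> p 2 c"
    "p 1 a \<or> p 1 b \<or> p 3 a \<or> p 3 b" "p 1 a \<or> p 1 c \<or> p 3 a \<or> p 3 c" "p 1 b \<or> p 1 c \<or> p 3 b \<or> p 3 c"
    "p 2 a \<or> p 2 b \<or> p 3 a \<or> p 3 b" "p 2 a \<or> p 2 c \<or> p 3 a \<or> p 3 c" "p 2 b \<or> p 2 c \<or> p 3 b \<or> p 3 c"
    unfolding p_def using sums nn3 by linarith+
  have three_rows: "p 1 a \<or> p 2 a \<or> p 3 a" "p 1 b \<or> p 2 b \<or> p 3 b" "p 1 c \<or> p 2 c \<or> p 3 c"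
    unfolding p_def using sums nn3 by linarith+
  have "\<exists>x y z. {x, y, z} = {a, b, c} \<and> p 1 x \<and> p 2 y \<and> p 3 z"
  proof -
    have "p 1 a \<and> p 2 b \<and> p 3 c \<or> p 1 a \<and> p 2 c \<and> p 3 b \<or> p 1 b \<and> p 2 a \<and> p 3 c \<or>
          p 1 b \<and> p 2 c \<and> p 3 a \<or> p 1 c \<and> p 2 a \<and> p 3 b \<or> p 1 c \<and> p 2 b \<and> p 3 a"
      using one_row two_rows three_rows by argo
    moreover have "{a, c, b} = {a, b, c}" "{b, a, c} = {a, b, c}" "{b, c, a} = {a, b, c}"
      "{c, a, b} = {a, b, c}" "{c, b, a} = {a, b, c}" by auto
    ultimately show ?thesis by metis
  qed
  then obtain x y z where xyz: "{x, y, z} = {a, b, c}" and pos: "w 1 x > 0" "w 2 y > 0" "w 3 z > 0"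
    unfolding p_def by blast
  define \<pi> where "\<pi> i = (if i = 1 then x else if i = 2 then y else if i = 3 then z
    else if i = 4 then j0 else i)" for i :: nat
  have "bij_betw \<pi> {1..4} {1..4}"
  proof -
    have "\<pi> ` {1..4} = insert j0 {x, y, z}"
      unfolding atLeast1AtMost_3_4 by (auto simp: \<pi>_def)
    also have "\<dots> = {1..4}" using xyz abc(2) by auto
    finally show ?thesis
      by (simp add: bij_betw_def eq_card_imp_inj_on)
  qed
  then have "\<pi> permutes {1..4}"
    by (rule bij_imp_permutes) (auto simp: \<pi>_def)
  then show ?thesis
    using pos unfolding atLeast1AtMost_3_4 by (intro exI[of _ \<pi>]) (auto simp: \<pi>_def)
qed

section \<open>The four sectors of two hyperplanes\<close>

definition row_sign :: "nat \<Rightarrow> real" where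
  "row_sign j = (if j \<le> 2 then 1 else -1)"

definition col_sign :: "nat \<Rightarrow> real" where
  "col_sign j = (if odd j then 1 else -1)"

text \<open>
Sectors \<open>1, 2, 3, 4\<close> are top left, top right, bottom left and bottom right, where top and left
are the positive sides of the first and second hyperplane. The equations are allowed to degenerate,
so that a sector may be empty and a side may be the whole space.
\<close>
definition sector :: "'a::real_inner \<Rightarrow> real \<Rightarrow> 'a \<Rightarrow> real \<Rightarrow> nat \<Rightarrow> 'a set" where
  "sector n c m d j = {z. 0 < row_sign j * (n \<bullet> z - c) \<and> 0 < col_sign j * (m \<bullet> z - d)}"

lemma sector_simps:
  "sector n c m d 1 = {z. n \<bullet> z > c \<and> m \<bullet> z > d}"
  "sector n c m d 2 = {z. n \<bullet> z > c \<and> m \<bullet> z < d}"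
  "sector n c m d 3 = {z. n \<bullet> z < c \<and> m \<bullet> z > d}"
  "sector n c m d 4 = {z. n \<bullet> z < c \<and> m \<bullet> z < d}"
  by (auto simp: sector_def row_sign_def col_sign_def)

lemma open_sector: "open (sector n c m d j)"
  unfolding sector_def by (intro open_Collect_conj open_Collect_less continuous_intros)

lemma convex_sector: "convex (sector n c m d j)"
proof -
  have "sector n c m d j = {z. (row_sign j *\<^sub>R n) \<bullet> z > row_sign j * c} \<inter>
      {z. (col_sign j *\<^sub>R m) \<bullet> z > col_sign j * d}"
    by (auto simp: sector_def algebra_simps)
  then show ?thesis
    by (simp only: convex_Int convex_halfspace_gt)
qed

lemma sectors_disjoint:
  assumes "j \<in> {1..4}" "k \<in> {1..4}" "j \<noteq> k"
  shows "sector n c m d j \<inter> sector n c m d k = {}"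
  using assms unfolding atLeast1AtMost_3_4 by (auto simp: sector_def row_sign_def col_sign_def)

lemma Union_sectors:
  "(\<Union>j\<in>{1..4}. sector n c m d j) = - ({z. n \<bullet> z = c} \<union> {z. m \<bullet> z = d})"
  unfolding atLeast1AtMost_3_4
  by (auto simp: sector_simps not_less_iff_gr_or_eq simp del: One_nat_def)

lemma sectors_nonempty_imp_normals_nonzero:
  assumes "\<And>j. j \<in> {1..4} \<Longrightarrow> sector n c m d j \<noteq> {}"
  shows "n \<noteq> 0" "m \<noteq> 0"
  using assms[of 1] assms[of 4] by (auto simp: sector_simps simp del: One_nat_def)

text \<open>
Nonemptiness of all four sectors is the only condition that two equations must satisfy in order to
define lines in general position: it forces both normals to be nonzero, and the four sectors,
being disjoint, open and connected, are then the components of the complement of the lines.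
Convexity makes each sector the interior
of its closure, which keeps the closures distinct.
\<close>
lemma sectors_split_by_two_lines:
  fixes n m :: "real ^ 2"
  assumes ne: "\<And>j. j \<in> {1..4} \<Longrightarrow> sector n c m d j \<noteq> {}"
  shows "split_by_two_lines {z. n \<bullet> z = c} {z. m \<bullet> z = d} (\<lambda>j. closure (sector n c m d j))"
    and "is_partition 4 (\<lambda>j. closure (sector n c m d j))"
proof -
  let ?S = "sector n c m d" and ?L = "{z. n \<bullet> z = c}" and ?M = "{z. m \<bullet> z = d}"
  note nz = sectors_nonempty_imp_normals_nonzero[of n c m d, OF ne]
  have interior_closure: "interior (closure (?S j)) = ?S j" for j
    by (simp add: convex_interior_closure convex_sector interior_open open_sector)
  have "pairwise disjnt (?S ` {1..4})"
    using sectors_disjoint[of _ _ n c m d] unfolding pairwise_def disjnt_def by blast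
  then have "components (- (?L \<union> ?M)) = ?S ` {1..4}"
    by (intro components_open_unique)
      (use ne in \<open>auto simp: Union_sectors[simplified] open_sector convex_connected convex_sector\<close>)
  moreover have "inj_on (\<lambda>j. closure (?S j)) {1..4}"
  proof (rule inj_onI)
    fix j k :: nat assume jk: "j \<in> {1..4}" "k \<in> {1..4}" "closure (?S j) = closure (?S k)"
    then have "?S j = ?S k" by (metis interior_closure)
    with jk show "j = k" using ne[of j] sectors_disjoint[of j k n c m d] by blast
  qed
  moreover have "is_line ?L" "is_line ?M"
    using nz by (auto simp: is_line_def affine_hyperplane)
  ultimately show "split_by_two_lines ?L ?M (\<lambda>j. closure (?S j))"
    by (simp add: split_by_two_lines_def pieces_def bij_betw_def image_image)
  have "interior (?L \<union> ?M) = {}"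
    using nz by (subst interior_closed_Un_empty_interior) (auto simp: closed_hyperplane)
  then have "closure (\<Union>j\<in>{1..4}. ?S j) = UNIV"
    by (simp only: Union_sectors closure_complement) simp
  then have "(\<Union>j\<in>{1..4}. closure (?S j)) = UNIV"
    by (simp add: atLeast1AtMost_3_4(2)[simplified])
  then show "is_partition 4 (\<lambda>j. closure (?S j))"
    using sectors_disjoint[of _ _ n c m d]
    unfolding is_partition_def interior_closure by (intro conjI ballI impI closed_closure)
qed

section \<open>Absolutely continuous measures of sectors\<close>

lemma negligible_null_sets_ac:
  assumes "ac_prob_measure \<mu>" "negligible N" "N \<in> sets borel"
  shows "N \<in> null_sets \<mu>"
proof -
  have "N \<in> null_sets lborel"
    using assms(2,3) by (simp add: negligible_iff_null_sets null_sets_completion_iff)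
  with assms(1) show ?thesis
    by (auto simp: ac_prob_measure_def absolutely_continuous_def)
qed

lemma measure_closure_convex_ac:
  fixes S :: "(real ^ 'd) set"
  assumes "ac_prob_measure \<mu>" "convex S" "open S"
  shows "measure \<mu> (closure S) = measure \<mu> S"
proof -
  have "frontier S \<in> null_sets \<mu>"
    using assms by (intro negligible_null_sets_ac negligible_convex_frontier borel_closed frontier_closed)
  moreover have "closure S = S \<union> frontier S"
    using assms(3) by (simp add: closure_Un_frontier)
  moreover have "S \<in> sets \<mu>"
    using assms by (simp add: ac_prob_measure_def)
  ultimately show ?thesis
    by (simp add: measure_Un_null_set)
qed

text \<open>
The condition also admits \<open>n = 0\<close> with \<open>c\<close> nonzero, where the set is empty: this covers a
line that has escaped to infinity.
\<close>
lemma hyperplane_null_ac: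
  fixes n :: "real ^ 'd"
  assumes "ac_prob_measure \<mu>" "n \<noteq> 0 \<or> c \<noteq> 0"
  shows "{z. n \<bullet> z = c} \<in> null_sets \<mu>"
  using assms by (intro negligible_null_sets_ac negligible_hyperplane borel_closed closed_hyperplane)

lemma sum_measure_sectors:
  fixes n m :: "real ^ 'd"
  assumes ac: "ac_prob_measure \<mu>" and "n \<noteq> 0 \<or> c \<noteq> 0" "m \<noteq> 0 \<or> d \<noteq> 0"
  shows "(\<Sum>j\<in>{1..4}. measure \<mu> (sector n c m d j)) = 1"
proof -
  interpret prob_space \<mu> using ac by (simp add: ac_prob_measure_def)
  have sets: "sets \<mu> = sets borel" using ac by (simp add: ac_prob_measure_def)
  have sp: "space \<mu> = UNIV" using sets_eq_imp_space_eq[OF sets] by simp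
  let ?N = "{z. n \<bullet> z = c} \<union> {z. m \<bullet> z = d}"
  have null: "?N \<in> null_sets \<mu>"
    using assms by (intro null_sets.Un hyperplane_null_ac)
  have "(\<Sum>j\<in>{1..4}. prob (sector n c m d j)) = prob (\<Union>j\<in>{1..4}. sector n c m d j)"
    by (intro finite_measure_finite_Union[symmetric])
      (use sectors_disjoint[of _ _ n c m d] in
        \<open>auto simp: sets open_sector disjoint_family_on_def simp del: atLeastAtMost_iff\<close>)
  also have "\<dots> = prob (space \<mu> - ?N)"
    unfolding Union_sectors sp by (simp add: Compl_eq_Diff_UNIV)
  also have "\<dots> = 1"
    using null by (simp add: prob_compl null_setsD2 measure_eq_0_null_sets)
  finally show ?thesis .
qed

text \<open>
By dominated convergence: a point off both limiting hyperplanes eventually stays in, or stays out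
of, the sector, and almost every point is off them.
\<close>
lemma continuous_on_measure_sector:
  fixes n m :: "'a::metric_space \<Rightarrow> real ^ 'd"
  assumes ac: "ac_prob_measure \<mu>"
    and cont: "continuous_on S n" "continuous_on S c" "continuous_on S m" "continuous_on S d"
    and nz: "\<And>x. x \<in> S \<Longrightarrow> n x \<noteq> 0 \<or> c x \<noteq> 0" "\<And>x. x \<in> S \<Longrightarrow> m x \<noteq> 0 \<or> d x \<noteq> 0"
  shows "continuous_on S (\<lambda>x. measure \<mu> (sector (n x) (c x) (m x) (d x) j))"
proof -
  interpret prob_space \<mu> using ac by (simp add: ac_prob_measure_def)
  have sets: "sets \<mu> = sets borel" using ac by (simp add: ac_prob_measure_def)
  define I where "I x = (indicator (sector (n x) (c x) (m x) (d x) j) :: _ \<Rightarrow> real)" for x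
  have [measurable]: "sector (n x) (c x) (m x) (d x) j \<in> sets \<mu>" for x
    by (simp add: sets open_sector)
  have I_meas: "I x \<in> borel_measurable \<mu>" for x
    unfolding I_def by measurable
  have signs: "row_sign j \<noteq> 0" "col_sign j \<noteq> 0" by (auto simp: row_sign_def col_sign_def)
  have "continuous_on S (\<lambda>x. integral\<^sup>L \<mu> (I x))"
    unfolding continuous_on_sequentially
  proof (intro ballI allI impI, elim conjE, unfold o_def)
    fix X x assume X: "\<forall>k. X k \<in> S" "X \<longlonglongrightarrow> x" and x: "x \<in> S"
    have lim: "(\<lambda>k. f (X k)) \<longlonglongrightarrow> f x" if "continuous_on S f" for f :: "'a \<Rightarrow> 'b::topological_space"
      using that X x unfolding continuous_on_sequentially by (auto simp: o_def)
    have off_lines: "AE z in \<mu>. n x \<bullet> z \<noteq> c x \<and> m x \<bullet> z \<noteq> d x"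
      using AE_not_in[OF hyperplane_null_ac[OF ac nz(1)[OF x]]]
        AE_not_in[OF hyperplane_null_ac[OF ac nz(2)[OF x]]] by eventually_elim simp
    show "(\<lambda>k. integral\<^sup>L \<mu> (I (X k))) \<longlonglongrightarrow> integral\<^sup>L \<mu> (I x)"
    proof (rule integral_dominated_convergence[where w = "\<lambda>_. 1"])
      show "AE z in \<mu>. (\<lambda>k. I (X k) z) \<longlonglongrightarrow> I x z"
        using off_lines
      proof eventually_elim
        case (elim z)
        define u where "u y = row_sign j * (n y \<bullet> z - c y)" for y
        define v where "v y = col_sign j * (m y \<bullet> z - d y)" for y
        have "continuous_on S u" "continuous_on S v"
          unfolding u_def v_def by (intro continuous_intros cont)+
        note uv = lim[OF this(1)] lim[OF this(2)]
        have "u x \<noteq> 0" "v x \<noteq> 0"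
          using elim signs by (auto simp: u_def v_def)
        then consider "u x > 0" "v x > 0" | "u x < 0" | "v x < 0" by linarith
        then have "eventually (\<lambda>k. I (X k) z = I x z) sequentially"
        proof cases
          case 1
          have "eventually (\<lambda>k. u (X k) > 0) sequentially" "eventually (\<lambda>k. v (X k) > 0) sequentially"
            using uv 1 by (auto dest: order_tendstoD(1))
          then show ?thesis
            by eventually_elim (use 1 in \<open>simp add: I_def sector_def u_def v_def\<close>)
        next
          case 2
          have "eventually (\<lambda>k. u (X k) < 0) sequentially"
            using uv 2 by (auto dest: order_tendstoD(2))
          then show ?thesis
            by eventually_elim (use 2 in \<open>simp add: I_def sector_def u_def v_def\<close>)
        next
          case 3
          have "eventually (\<lambda>k. v (X k) < 0) sequentially"
            using uv 3 by (auto dest: order_tendstoD(2))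
          then show ?thesis
            by eventually_elim (use 3 in \<open>simp add: I_def sector_def u_def v_def\<close>)
        qed
        then show ?case by (rule tendsto_eventually)
      qed
    qed (auto simp: I_meas, simp add: I_def)
  qed
  then show ?thesis by (simp add: I_def)
qed

section \<open>Envy-freeness for every choice of the fourth person\<close>

text \<open>
A continuous substitute for the indicator of the favourites of \<open>v\<close>: the factor for \<open>k\<close>
vanishes as soon as \<open>k\<close> beats \<open>j\<close> by \<open>\<epsilon>\<close> or more.
\<close>
definition preference_weight :: "real \<Rightarrow> 'j set \<Rightarrow> ('j \<Rightarrow> real) \<Rightarrow> 'j \<Rightarrow> real" where
  "preference_weight \<epsilon> J v j = (\<Prod>k\<in>J. max 0 (v j - v k + \<epsilon>))"

lemma preference_weight_nonneg: "0 \<le> preference_weight \<epsilon> J v j"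
  by (simp add: preference_weight_def prod_nonneg)

lemma preference_weight_pos_imp:
  assumes "finite J" "0 < preference_weight \<epsilon> J v j" "k \<in> J"
  shows "v k < v j + \<epsilon>"
proof (rule ccontr)
  assume "\<not> ?thesis"
  then have "max 0 (v j - v k + \<epsilon>) = 0" by simp
  then have "preference_weight \<epsilon> J v j = 0"
    unfolding preference_weight_def using assms(1,3) by (intro prod_zero) auto
  with assms(2) show False by simp
qed

lemma sum_preference_weight_pos:
  assumes "finite J" "J \<noteq> {}" "0 < \<epsilon>"
  shows "0 < (\<Sum>j\<in>J. preference_weight \<epsilon> J v j)"
proof -
  have "Max (v ` J) \<in> v ` J" using assms by (intro Max_in) auto
  then obtain j where j: "j \<in> J" "v j = Max (v ` J)" by auto
  have "0 < max 0 (v j - v k + \<epsilon>)" if "k \<in> J" for k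
  proof -
    have "v k \<le> v j" using that assms(1) by (simp add: j(2))
    with \<open>0 < \<epsilon>\<close> show ?thesis by simp
  qed
  then have "0 < preference_weight \<epsilon> J v j"
    by (simp add: preference_weight_def prod_pos)
  with j(1) assms(1) show ?thesis
    by (intro sum_pos2[of J j]) (auto simp: preference_weight_nonneg)
qed

text \<open>
What the combinatorial argument needs to know about the configurations: \<open>v x i j\<close> is the value
for person \<open>i\<close> of piece \<open>j\<close> in configuration \<open>x\<close>, and worthless pieces occur on the faces
of the cube as they do for the two lines described above.
\<close>
locale piece_values =
  fixes v :: "real ^ 3 \<Rightarrow> nat \<Rightarrow> nat \<Rightarrow> real"
  assumes cont: "\<And>i j. i \<in> {1..3} \<Longrightarrow> j \<in> {1..4} \<Longrightarrow> continuous_on (cbox (-1) 1) (\<lambda>x. v x i j)"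
    and total: "\<And>x i. x \<in> cbox (-1) 1 \<Longrightarrow> i \<in> {1..3} \<Longrightarrow> (\<Sum>j\<in>{1..4}. v x i j) = 1"
    and faces: "\<And>x i. x \<in> cbox (-1) 1 \<Longrightarrow> i \<in> {1..3} \<Longrightarrow>
      (x $ 1 = -1 \<longrightarrow> v x i 1 = 0 \<and> v x i 2 = 0) \<and> (x $ 1 = 1 \<longrightarrow> v x i 3 = 0 \<and> v x i 4 = 0) \<and>
      (x $ 2 = -1 \<longrightarrow> v x i 1 = 0) \<and> (x $ 2 = 1 \<longrightarrow> v x i 2 = 0) \<and>
      (x $ 3 = -1 \<longrightarrow> v x i 3 = 0) \<and> (x $ 3 = 1 \<longrightarrow> v x i 4 = 0)"
begin

text \<open>
The bound \<open>1/4\<close> makes a worthless piece weightless: each person values some piece at \<open>1/4\<close>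
or more, and this piece beats a worthless one by at least \<open>\<epsilon>\<close>.
\<close>
lemma almost_envy_free_for_every_choice:
  assumes \<epsilon>: "0 < \<epsilon>" "\<epsilon> \<le> 1/4"
  obtains x where "x \<in> cbox (-1) 1"
    "\<And>j0. j0 \<in> {1..4} \<Longrightarrow> \<exists>\<pi>. \<pi> permutes {1..4} \<and> \<pi> 4 = j0 \<and>
       (\<forall>i\<in>{1..3}. \<forall>k\<in>{1..4}. v x i k < v x i (\<pi> i) + \<epsilon>)"
proof -
  let ?J = "{1..4::nat}"
  define w where "w x i j = preference_weight \<epsilon> ?J (v x i) j /
    (\<Sum>k\<in>?J. preference_weight \<epsilon> ?J (v x i) k)" for x i j
  define W where "W x j = (\<Sum>i\<in>{1..3}. w x i j)" for x j
  have denom: "0 < (\<Sum>k\<in>?J. preference_weight \<epsilon> ?J (v x i) k)" for x i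
    using \<epsilon>(1) by (intro sum_preference_weight_pos) auto
  have w_nonneg: "0 \<le> w x i j" for x i j
    unfolding w_def by (intro divide_nonneg_pos preference_weight_nonneg denom)
  have w_pos: "v x i k < v x i j + \<epsilon>" if "0 < w x i j" "k \<in> ?J" for x i j k
    using that denom[of x i] preference_weight_nonneg[of \<epsilon> ?J "v x i" j]
    by (intro preference_weight_pos_imp[of ?J]) (auto simp: w_def zero_less_divide_iff)
  have w_sum: "(\<Sum>j\<in>?J. w x i j) = 1" for x i
    using denom[of x i] unfolding w_def sum_divide_distrib[symmetric] by simp
  have w_zero: "w x i j = 0" if x: "x \<in> cbox (-1) 1" "i \<in> {1..3}" and "v x i j = 0" for x i j
  proof (rule ccontr)
    assume "w x i j \<noteq> 0"
    then have "0 < w x i j" using w_nonneg[of x i j] by simp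
    then have "v x i k < \<epsilon>" if "k \<in> ?J" for k using w_pos that \<open>v x i j = 0\<close> by fastforce
    then have "(\<Sum>k\<in>?J. v x i k) < (\<Sum>k\<in>?J. \<epsilon>)" by (intro sum_strict_mono) auto
    with total[OF x] \<epsilon>(2) show False by simp
  qed
  have W_nonneg: "0 \<le> W x j" for x j
    unfolding W_def by (intro sum_nonneg w_nonneg)
  have W_zero: "W x j = 0" if "x \<in> cbox (-1) 1" "\<And>i. i \<in> {1..3} \<Longrightarrow> v x i j = 0" for x j
    unfolding W_def using w_zero that by (intro sum.neutral) auto
  have "(\<Sum>j\<in>?J. W x j) = 3" for x
  proof -
    have "(\<Sum>j\<in>?J. W x j) = (\<Sum>i\<in>{1..3}. \<Sum>j\<in>?J. w x i j)"
      unfolding W_def by (rule sum.swap)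
    then show ?thesis unfolding w_sum by simp
  qed
  then have W_total: "W x 1 + W x 2 + W x 3 + W x 4 = 3" for x
    unfolding atLeast1AtMost_3_4 by (simp add: algebra_simps)
  have W_cont: "continuous_on (cbox (-1) 1) (\<lambda>x. W x j)" if "j \<in> ?J" for j
  proof -
    have weight: "continuous_on (cbox (-1) 1) (\<lambda>x. preference_weight \<epsilon> ?J (v x i) k)"
      if "i \<in> {1..3}" "k \<in> ?J" for i k
      unfolding preference_weight_def by (intro continuous_intros cont that)
    show ?thesis
      unfolding W_def w_def
      by (intro continuous_on_sum continuous_on_divide weight that ballI
          denom[THEN less_imp_neq, THEN not_sym])
  qed
  \<comment> \<open>Since the four totals add up to \<open>3\<close>, a common zero is a point where all are equal.\<close>
  define f where "f i x = (if i = 1 then W x 1 + W x 2 - 3/2 else if i = 2 then W x 1 - W x 2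
    else W x 3 - W x 4)" for i :: 3 and x
  obtain x where x: "x \<in> cbox (-1) 1" and f0: "\<And>i. f i x = 0"
  proof (rule poincare_miranda[of "-1" 1 f])
    show "continuous_on (cbox (-1) 1) (f i)" for i
      unfolding f_def using exhaust_3[of i] by (auto intro!: continuous_intros W_cont)
  next
    fix x :: "real ^ 3" and i :: 3
    assume x: "x \<in> cbox (-1) 1" and xi: "x $ i = (-1) $ i"
    consider "i = 1" | "i = 2" | "i = 3" using exhaust_3 by blast
    then show "f i x \<le> 0"
    proof cases
      case 1
      then have "W x 1 = 0" "W x 2 = 0" using faces[OF x] xi by (auto intro!: W_zero[OF x])
      with 1 show ?thesis by (simp add: f_def)
    next
      case 2
      then have "W x 1 = 0" using faces[OF x] xi by (auto intro!: W_zero[OF x])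
      with 2 show ?thesis using W_nonneg[of x 2] by (simp add: f_def)
    next
      case 3
      then have "W x 3 = 0" using faces[OF x] xi by (auto intro!: W_zero[OF x])
      with 3 show ?thesis using W_nonneg[of x 4] by (simp add: f_def)
    qed
  next
    fix x :: "real ^ 3" and i :: 3
    assume x: "x \<in> cbox (-1) 1" and xi: "x $ i = 1 $ i"
    consider "i = 1" | "i = 2" | "i = 3" using exhaust_3 by blast
    then show "0 \<le> f i x"
    proof cases
      case 1
      then have "W x 3 = 0" "W x 4 = 0" using faces[OF x] xi by (auto intro!: W_zero[OF x])
      with 1 show ?thesis using W_total[of x] by (simp add: f_def)
    next
      case 2
      then have "W x 2 = 0" using faces[OF x] xi by (auto intro!: W_zero[OF x])
      with 2 show ?thesis using W_nonneg[of x 1] by (simp add: f_def)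
    next
      case 3
      then have "W x 4 = 0" using faces[OF x] xi by (auto intro!: W_zero[OF x])
      with 3 show ?thesis using W_nonneg[of x 3] by (simp add: f_def)
    qed
  qed (auto)
  have "W x j = 3/4" if "j \<in> ?J" for j
    using that W_total[of x] f0[of 1] f0[of 2] f0[of 3]
    unfolding atLeast1AtMost_3_4 by (auto simp: f_def)
  then have cols: "(\<Sum>i\<in>{1..3}. w x i j) = 3/4" if "j \<in> ?J" for j
    using that by (simp only: W_def)
  show thesis
  proof (rule that[OF x])
    fix j0 assume "j0 \<in> ?J"
    then obtain \<pi> where "\<pi> permutes ?J" "\<pi> 4 = j0" "\<forall>i\<in>{1..3}. 0 < w x i (\<pi> i)"
      using positive_matching_avoiding_column[of "w x", OF w_nonneg w_sum cols] by blast
    then show "\<exists>\<pi>. \<pi> permutes ?J \<and> \<pi> 4 = j0 \<and>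
       (\<forall>i\<in>{1..3}. \<forall>k\<in>?J. v x i k < v x i (\<pi> i) + \<epsilon>)"
      using w_pos by blast
  qed
qed

text \<open>
For a cluster point of almost envy-free configurations, a permutation that causes strict envy
there causes envy by more than \<open>\<epsilon>\<close> at all late members of the sequence; as there are only
finitely many permutations, one that is good for late members is good in the limit.
\<close>
theorem envy_free_for_every_choice:
  obtains x where "x \<in> cbox (-1) 1"
    "\<And>j0. j0 \<in> {1..4} \<Longrightarrow> \<exists>\<pi>. \<pi> permutes {1..4} \<and> \<pi> 4 = j0 \<and>
       (\<forall>i\<in>{1..3}. \<forall>k\<in>{1..4}. v x i k \<le> v x i (\<pi> i))"
proof -
  let ?J = "{1..4::nat}"
  define \<epsilon> :: "nat \<Rightarrow> real" where "\<epsilon> n = inverse (real (Suc n)) / 4" for n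
  have "\<exists>x. x \<in> cbox (-1) 1 \<and> (\<forall>j0\<in>?J. \<exists>\<pi>. \<pi> permutes ?J \<and> \<pi> 4 = j0 \<and>
       (\<forall>i\<in>{1..3}. \<forall>k\<in>?J. v x i k < v x i (\<pi> i) + \<epsilon> n))" for n
  proof -
    have "0 < \<epsilon> n" "\<epsilon> n \<le> 1/4" by (auto simp: \<epsilon>_def field_simps)
    from almost_envy_free_for_every_choice[OF this] show ?thesis by metis
  qed
  then obtain X where X: "\<And>n. X n \<in> cbox (-1) 1"
    and approx: "\<And>n j0. j0 \<in> ?J \<Longrightarrow> \<exists>\<pi>. \<pi> permutes ?J \<and> \<pi> 4 = j0 \<and>
       (\<forall>i\<in>{1..3}. \<forall>k\<in>?J. v (X n) i k < v (X n) i (\<pi> i) + \<epsilon> n)"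
    by metis
  obtain x r where x: "x \<in> cbox (-1) 1" and r: "strict_mono r" "(X \<circ> r) \<longlonglongrightarrow> x"
    using X compact_cbox[of "-1 :: real ^ 3" 1] unfolding compact_def by metis
  have "\<epsilon> \<longlonglongrightarrow> 0"
    unfolding \<epsilon>_def by (intro tendsto_divide_zero LIMSEQ_inverse_real_of_nat)
  then have \<epsilon>_lim: "(\<lambda>n. \<epsilon> (r n)) \<longlonglongrightarrow> 0"
    using LIMSEQ_subseq_LIMSEQ[OF _ r(1)] by (auto simp: o_def)
  have v_lim: "(\<lambda>n. v (X (r n)) i j) \<longlonglongrightarrow> v x i j" if "i \<in> {1..3}" "j \<in> ?J" for i j
    using cont[OF that] x X r(2) unfolding continuous_on_sequentially by (auto simp: o_def)
  show thesis
  proof (rule that[OF x], rule ccontr)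
    fix j0 assume j0: "j0 \<in> ?J"
    define P where "P = {\<pi>. \<pi> permutes ?J \<and> \<pi> 4 = j0}"
    assume no_matching: "\<nexists>\<pi>. \<pi> permutes ?J \<and> \<pi> 4 = j0 \<and> (\<forall>i\<in>{1..3}. \<forall>k\<in>?J. v x i k \<le> v x i (\<pi> i))"
    have envy: "\<exists>i\<in>{1..3}. \<exists>k\<in>?J. v x i k > v x i (\<pi> i)" if "\<pi> \<in> P" for \<pi>
    proof (rule ccontr)
      assume "\<not> ?thesis"
      then have "\<forall>i\<in>{1..3}. \<forall>k\<in>?J. v x i k \<le> v x i (\<pi> i)" 
        by (simp add: not_less)
      with that no_matching show False unfolding P_def by blast
    qed
    have "eventually (\<lambda>n. \<exists>i\<in>{1..3}. \<exists>k\<in>?J. v (X (r n)) i k > v (X (r n)) i (\<pi> i) + \<epsilon> (r n)) sequentially"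
      if \<pi>: "\<pi> \<in> P" for \<pi>
    proof -
      obtain i k where ik: "i \<in> {1..3}" "k \<in> ?J" "v x i k > v x i (\<pi> i)"
        using envy[OF \<pi>] by blast
      have "\<pi> i \<in> ?J"
        using ik(1) \<pi> permutes_in_image[of \<pi> ?J i] by (auto simp: P_def)
      then have "(\<lambda>n. v (X (r n)) i k - (v (X (r n)) i (\<pi> i) + \<epsilon> (r n))) \<longlonglongrightarrow> v x i k - (v x i (\<pi> i) + 0)"
        by (intro tendsto_intros v_lim ik \<epsilon>_lim)
      then have "eventually (\<lambda>n. v (X (r n)) i k - (v (X (r n)) i (\<pi> i) + \<epsilon> (r n)) > 0) sequentially"
        using ik(3) by (intro order_tendstoD(1)) auto
      then show ?thesis
        by eventually_elim (use ik in force)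
    qed
    moreover have "finite P"
      unfolding P_def by (rule finite_subset[OF _ finite_permutations[of ?J]]) auto
    ultimately have "eventually (\<lambda>n. \<forall>\<pi>\<in>P. \<exists>i\<in>{1..3}. \<exists>k\<in>?J.
        v (X (r n)) i k > v (X (r n)) i (\<pi> i) + \<epsilon> (r n)) sequentially"
      by (intro eventually_ball_finite) auto
    then obtain n where "\<forall>\<pi>\<in>P. \<exists>i\<in>{1..3}. \<exists>k\<in>?J. v (X (r n)) i k > v (X (r n)) i (\<pi> i) + \<epsilon> (r n)"
      unfolding eventually_sequentially by blast
    moreover obtain \<pi> where "\<pi> \<in> P"
      "\<forall>i\<in>{1..3}. \<forall>k\<in>?J. v (X (r n)) i k < v (X (r n)) i (\<pi> i) + \<epsilon> (r n)"
      using approx[OF j0, of "r n"] unfolding P_def by blast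
    ultimately show False using less_asym by blast
  qed
qed

end

section \<open>A cube of pairs of lines\<close>

text \<open>
In terms of \<open>A = a * y + b\<close> and \<open>B = b * y - a\<close>, the line \<open>L\<close> is \<open>b * A + a * B = 0\<close>
and the line \<open>M\<close> is \<open>p * A - q * B = u * x\<close>; the upper side of \<open>L\<close> and the left side of
\<open>M\<close> are the positive ones. Here \<open>a, b \<ge> 0\<close> with \<open>a + b = 2\<close>, so \<open>L\<close> has height
\<open>(a\<^sup>2 - b\<^sup>2) / (2 * a * b)\<close>, which tends to plus infinity as \<open>b\<close> tends to \<open>0\<close> and to
minus infinity as \<open>a\<close> tends to \<open>0\<close>. The identity \<open>b * A - a * B = a\<^sup>2 + b\<^sup>2 > 0\<close> gives
\<open>b * A > \<bar>a * B\<bar>\<close> above \<open>L\<close> and \<open>- a * B > \<bar>b * A\<bar>\<close> below \<open>L\<close>.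

The coefficient \<open>u\<close> vanishes on the four side faces of the cube, where \<open>M\<close> becomes horizontal;
the two inequalities then show which side of \<open>M\<close> contains a whole side of \<open>L\<close>. The simpler
choice of \<open>b\<close> and \<open>a\<close> times the second and third coordinate for \<open>p\<close> and \<open>q\<close> would
achieve this too, but with it \<open>p\<close>, \<open>q\<close> and \<open>u\<close> can all vanish when \<open>L\<close> is at infinity.
The additional terms prevent this, and each is \<open>0\<close> on the two faces where the argument bounds the
modulus of its coefficient from above.
\<close>
definition line_parameters :: "real ^ 3 \<Rightarrow> real \<times> real \<times> real \<times> real \<times> real" where
  "line_parameters x = (let a = 1 - x $ 1; b = 1 + x $ 1 in
    (a, b, x $ 2 * (b + a * (1 - (x $ 3)\<^sup>2)), x $ 3 * (a + b * (1 - (x $ 2)\<^sup>2)),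
     (1 - (x $ 2)\<^sup>2) * (1 - (x $ 3)\<^sup>2)))"

definition L_normal :: "real ^ 3 \<Rightarrow> real ^ 2" where
  "L_normal x = (case line_parameters x of (a, b, p, q, u) \<Rightarrow> (2 * a * b) *\<^sub>R axis 2 1)"

definition L_offset :: "real ^ 3 \<Rightarrow> real" where
  "L_offset x = (case line_parameters x of (a, b, p, q, u) \<Rightarrow> a\<^sup>2 - b\<^sup>2)"

definition M_normal :: "real ^ 3 \<Rightarrow> real ^ 2" where
  "M_normal x = (case line_parameters x of (a, b, p, q, u) \<Rightarrow>
     (- u) *\<^sub>R axis 1 1 + (p * a - q * b) *\<^sub>R axis 2 1)"

definition M_offset :: "real ^ 3 \<Rightarrow> real" where
  "M_offset x = (case line_parameters x of (a, b, p, q, u) \<Rightarrow> - (p * b + q * a))"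

abbreviation piece :: "real ^ 3 \<Rightarrow> nat \<Rightarrow> (real ^ 2) set" where
  "piece x \<equiv> sector (L_normal x) (L_offset x) (M_normal x) (M_offset x)"

lemmas line_defs = L_normal_def L_offset_def M_normal_def M_offset_def line_parameters_def Let_def

lemma L_nondegenerate: "L_normal x \<noteq> 0 \<or> L_offset x \<noteq> 0"
  by (auto simp: line_defs axis_eq_0_iff)

text \<open>
The linear map that takes \<open>(p, q)\<close> to the vertical component of the normal and the offset of \<open>M\<close>
multiplies squared lengths by \<open>a\<^sup>2 + b\<^sup>2\<close>, so degeneration would mean \<open>p = q = u = 0\<close>. Now
\<open>u = 0\<close> only on the side faces. If the second coordinate has modulus \<open>1\<close>, then \<open>p = 0\<close> forces
\<open>b = 0\<close> and a third coordinate of modulus \<open>1\<close>, for which \<open>q\<close> is nonzero; the other case is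
symmetric.
\<close>
lemma M_nondegenerate:
  assumes x: "x \<in> cbox (-1) 1"
  shows "M_normal x \<noteq> 0 \<or> M_offset x \<noteq> 0"
proof (rule ccontr)
  obtain a b p q u where par: "line_parameters x = (a, b, p, q, u)"
    by (cases "line_parameters x") auto
  note par_eq = par[unfolded line_parameters_def Let_def, simplified]
  assume "\<not> ?thesis"
  then have zero: "M_normal x $ 1 = 0" "M_normal x $ 2 = 0" "M_offset x = 0" by auto
  then have u: "u = 0" and pq: "p * a - q * b = 0" "p * b + q * a = 0"
    by (auto simp: M_normal_def M_offset_def par axis_def)
  have ab: "a + b = 2" using par_eq by auto
  have "0 < a\<^sup>2 + b\<^sup>2" using ab by (auto simp: sum_power2_gt_zero_iff)
  moreover have "(a\<^sup>2 + b\<^sup>2) * p = a * (p * a - q * b) + b * (p * b + q * a)"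
    "(a\<^sup>2 + b\<^sup>2) * q = a * (p * b + q * a) - b * (p * a - q * b)"
    by (simp_all add: algebra_simps power2_eq_square)
  ultimately have p: "x $ 2 * (b + a * (1 - (x $ 3)\<^sup>2)) = 0"
    and q: "x $ 3 * (a + b * (1 - (x $ 2)\<^sup>2)) = 0"
    unfolding pq using par_eq by auto
  have bounds: "\<bar>x $ i\<bar> \<le> 1" for i
    using x by (auto simp: mem_box_cart abs_le_iff minus_le_iff)
  have ab0: "0 \<le> a" "0 \<le> b" using par_eq bounds[of 1] by auto
  have contr: False
    if "0 \<le> c" "0 \<le> d" "c + d = 2" "s\<^sup>2 = 1" "\<bar>t\<bar> \<le> 1" "s * (d + c * (1 - t\<^sup>2)) = 0" "t * c = 0"
    for c d s t :: real
  proof -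
    have "0 \<le> c * (1 - t\<^sup>2)" using that by (simp add: abs_square_le_1)
    moreover have "d + c * (1 - t\<^sup>2) = 0" using that by auto
    ultimately have "d = 0" "c * (1 - t\<^sup>2) = 0" using that(2) by linarith+
    with that(3,7) show False by simp
  qed
  from u consider "(x $ 2)\<^sup>2 = 1" | "(x $ 3)\<^sup>2 = 1"
    using par_eq by auto
  then show False
  proof cases
    case 1
    with contr[of a b "x $ 2" "x $ 3"] ab0 ab bounds p q show ?thesis by simp
  next
    case 2
    with contr[of b a "x $ 3" "x $ 2"] ab0 ab bounds p q show ?thesis by simp
  qed
qed

lemma continuous_on_lines:
  "continuous_on S L_normal" "continuous_on S L_offset"
  "continuous_on S M_normal" "continuous_on S M_offset"
  unfolding line_defs[abs_def] prod.case by (intro continuous_intros)+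

text \<open>
The estimate behind the four side faces: \<open>(b + a * (1 - t\<^sup>2)) * A\<close> is at least \<open>b * A\<close>, while
\<open>\<bar>t * Y\<bar>\<close> is at most \<open>\<bar>Y\<bar>\<close>. It is applied above \<open>L\<close> with \<open>Y = a * B\<close>, and below
\<open>L\<close> with \<open>a\<close> and \<open>b\<close> exchanged, \<open>- B\<close> for \<open>A\<close> and \<open>Y = b * A\<close>.
\<close>
lemma abs_mult_less_of_dominated:
  fixes a b A Y t :: real
  assumes "0 \<le> a" "0 \<le> b" "\<bar>Y\<bar> < b * A" "\<bar>t\<bar> \<le> 1"
  shows "\<bar>t * Y\<bar> < (b + a * (1 - t\<^sup>2)) * A"
proof -
  have "0 < A" using assms(2,3) by (smt (verit) mult_nonneg_nonpos)
  moreover have "t\<^sup>2 \<le> 1" using assms(4) by (simp add: abs_square_le_1)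
  ultimately have "b * A \<le> (b + a * (1 - t\<^sup>2)) * A"
    using assms(1) by (intro mult_right_mono) auto
  moreover have "\<bar>t * Y\<bar> \<le> \<bar>Y\<bar>"
    using assms(4) by (simp add: abs_mult mult_left_le_one_le)
  ultimately show ?thesis using assms(3) by linarith
qed

text \<open>
On the faces of the first coordinate \<open>L\<close> is at infinity and one of its sides is empty. On the
other faces \<open>M\<close> is parallel to \<open>L\<close> or at infinity, and one whole side of \<open>L\<close> lies on one
side of \<open>M\<close>.
\<close>
lemma empty_pieces:
  assumes x: "x \<in> cbox (-1) 1"
  shows "x $ 1 = -1 \<Longrightarrow> piece x 1 = {}" "x $ 1 = -1 \<Longrightarrow> piece x 2 = {}"
    "x $ 1 = 1 \<Longrightarrow> piece x 3 = {}" "x $ 1 = 1 \<Longrightarrow> piece x 4 = {}"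
    "x $ 2 = -1 \<Longrightarrow> piece x 1 = {}" "x $ 2 = 1 \<Longrightarrow> piece x 2 = {}"
    "x $ 3 = -1 \<Longrightarrow> piece x 3 = {}" "x $ 3 = 1 \<Longrightarrow> piece x 4 = {}"
proof -
  define a b p q u where par: "a = 1 - x $ 1" "b = 1 + x $ 1"
    "p = x $ 2 * (b + a * (1 - (x $ 3)\<^sup>2))" "q = x $ 3 * (a + b * (1 - (x $ 2)\<^sup>2))"
    "u = (1 - (x $ 2)\<^sup>2) * (1 - (x $ 3)\<^sup>2)"
  define A B where "A z = a * z $ 2 + b" and "B z = b * z $ 2 - a" for z :: "real ^ 2"
  have bounds: "\<bar>x $ i\<bar> \<le> 1" for i
    using x by (auto simp: mem_box_cart abs_le_iff minus_le_iff)
  have ab: "0 \<le> a" "0 \<le> b" "a + b = 2" using bounds[of 1] by (auto simp: par)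
  have params: "line_parameters x = (a, b, p, q, u)"
    by (simp add: line_parameters_def par Let_def)
  have L: "L_normal x \<bullet> z - L_offset x = b * A z + a * B z" for z
    by (simp add: L_normal_def L_offset_def params A_def B_def inner_axis' algebra_simps
        power2_eq_square)
  have M: "M_normal x \<bullet> z - M_offset x = p * A z - q * B z - u * z $ 1" for z
    by (simp add: M_normal_def M_offset_def params A_def B_def inner_axis' algebra_simps
        inner_add_left)
  have sectors: "piece x 1 = {z. b * A z + a * B z > 0 \<and> p * A z - q * B z - u * z $ 1 > 0}"
    "piece x 2 = {z. b * A z + a * B z > 0 \<and> p * A z - q * B z - u * z $ 1 < 0}"
    "piece x 3 = {z. b * A z + a * B z < 0 \<and> p * A z - q * B z - u * z $ 1 > 0}"
    "piece x 4 = {z. b * A z + a * B z < 0 \<and> p * A z - q * B z - u * z $ 1 < 0}"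
    unfolding sector_simps L[symmetric] M[symmetric] by auto
  have gap: "a * B z < b * A z" for z
  proof -
    have "b * A z - a * B z = a\<^sup>2 + b\<^sup>2"
      by (simp add: A_def B_def algebra_simps power2_eq_square)
    also have "\<dots> > 0" using ab by (auto simp: sum_power2_gt_zero_iff)
    finally show ?thesis by simp
  qed
  define P Q where "P = b + a * (1 - (x $ 3)\<^sup>2)" and "Q = a + b * (1 - (x $ 2)\<^sup>2)"
  have top: "\<bar>x $ 3 * (a * B z)\<bar> < P * A z" if "b * A z + a * B z > 0" for z
    unfolding P_def using that gap[of z] ab bounds by (intro abs_mult_less_of_dominated) auto
  have bottom: "\<bar>x $ 2 * (b * A z)\<bar> < - (Q * B z)" if "b * A z + a * B z < 0" for z
    unfolding Q_def mult_minus_right[symmetric]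
    using that gap[of z] ab bounds by (intro abs_mult_less_of_dominated) auto
  have pq: "p = x $ 2 * P" "q = x $ 3 * Q"
    by (simp_all add: par P_def Q_def)
  have side: "(x $ 2)\<^sup>2 = 1 \<Longrightarrow> Q = a" "(x $ 3)\<^sup>2 = 1 \<Longrightarrow> P = b"
    "(x $ 2)\<^sup>2 = 1 \<Longrightarrow> u = 0" "(x $ 3)\<^sup>2 = 1 \<Longrightarrow> u = 0"
    by (simp_all add: par(5) P_def Q_def)
  have slant: "x $ 2 = -1 \<Longrightarrow> p * A z - q * B z - u * z $ 1 = - (P * A z) - x $ 3 * (a * B z)"
    "x $ 2 = 1 \<Longrightarrow> p * A z - q * B z - u * z $ 1 = P * A z - x $ 3 * (a * B z)"
    "x $ 3 = -1 \<Longrightarrow> p * A z - q * B z - u * z $ 1 = x $ 2 * (b * A z) + Q * B z"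
    "x $ 3 = 1 \<Longrightarrow> p * A z - q * B z - u * z $ 1 = x $ 2 * (b * A z) - Q * B z" for z
    by (simp_all add: pq side mult.assoc)
  show "piece x 1 = {}" "piece x 2 = {}" if "x $ 1 = -1"
    unfolding sectors using that by (auto simp: par A_def B_def)
  show "piece x 3 = {}" "piece x 4 = {}" if "x $ 1 = 1"
    unfolding sectors using that by (auto simp: par A_def B_def)
  show "piece x 1 = {}" if "x $ 2 = -1"
    unfolding sectors slant(1)[OF that] using top by fastforce
  show "piece x 2 = {}" if "x $ 2 = 1"
    unfolding sectors slant(2)[OF that] using top by fastforce
  show "piece x 3 = {}" if "x $ 3 = -1"
    unfolding sectors slant(3)[OF that] using bottom by fastforce
  show "piece x 4 = {}" if "x $ 3 = 1"
    unfolding sectors slant(4)[OF that] using bottom by fastforce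
qed

section \<open>Envy-free pairs of lines\<close>

lemma piece_values_measures:
  assumes "\<forall>i\<in>{1..3}. ac_prob_measure (\<mu> i)"
  shows "piece_values (\<lambda>x i j. measure (\<mu> i) (piece x j))"
proof
  fix i j :: nat assume "i \<in> {1..3}"
  then show "continuous_on (cbox (-1) 1) (\<lambda>x. measure (\<mu> i) (piece x j))"
    using assms L_nondegenerate M_nondegenerate
    by (intro continuous_on_measure_sector continuous_on_lines) auto
next
  fix x :: "real ^ 3" and i :: nat assume x: "x \<in> cbox (-1) 1" and "i \<in> {1..3}"
  then show "(\<Sum>j\<in>{1..4}. measure (\<mu> i) (piece x j)) = 1"
    using assms L_nondegenerate M_nondegenerate by (intro sum_measure_sectors) auto
next
  fix x :: "real ^ 3" and i :: nat assume x: "x \<in> cbox (-1) 1"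
  let ?v = "\<lambda>j. measure (\<mu> i) (piece x j)"
  show "(x $ 1 = -1 \<longrightarrow> ?v 1 = 0 \<and> ?v 2 = 0) \<and> (x $ 1 = 1 \<longrightarrow> ?v 3 = 0 \<and> ?v 4 = 0) \<and>
      (x $ 2 = -1 \<longrightarrow> ?v 1 = 0) \<and> (x $ 2 = 1 \<longrightarrow> ?v 2 = 0) \<and>
      (x $ 3 = -1 \<longrightarrow> ?v 3 = 0) \<and> (x $ 3 = 1 \<longrightarrow> ?v 4 = 0)"
    using empty_pieces[OF x] by (simp del: One_nat_def)
qed

lemma secretive_envy_free_lines:
  assumes ac: "\<forall>i\<in>{1..3}. ac_prob_measure (\<mu> i)"
  shows "\<exists>L M C. split_by_two_lines L M C \<and>
    (\<forall>\<mu>4. ac_prob_measure \<mu>4 \<longrightarrow> envy_free_partition 4 (\<mu>(4 := \<mu>4)) C)"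
proof -
  define v where "v = (\<lambda>x i j. measure (\<mu> i) (piece x j))"
  interpret piece_values v
    unfolding v_def using ac by (rule piece_values_measures)
  obtain x where x: "x \<in> cbox (-1) 1" and
    match: "\<And>j0. j0 \<in> {1..4} \<Longrightarrow> \<exists>\<pi>. \<pi> permutes {1..4} \<and> \<pi> 4 = j0 \<and>
       (\<forall>i\<in>{1..3}. \<forall>k\<in>{1..4}. v x i k \<le> v x i (\<pi> i))"
    using envy_free_for_every_choice by blast
  \<comment> \<open>If the fourth person takes another piece, then \<open>piece x j\<close> is a favourite of someone else
    and so has positive measure.\<close>
  have nonempty: "piece x j \<noteq> {}" if j: "j \<in> {1..4}" for j
  proof
    assume "piece x j = {}"
    obtain j0 :: nat where j0: "j0 \<in> {1..4}" "j0 \<noteq> j"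
      by (rule that[of "if j = 1 then 2 else 1"]) auto
    obtain \<pi> where \<pi>: "\<pi> permutes {1..4}" "\<pi> 4 = j0"
      "\<forall>i\<in>{1..3}. \<forall>k\<in>{1..4}. v x i k \<le> v x i (\<pi> i)"
      using match[OF j0(1)] by blast
    obtain i where i: "i \<in> {1..4}" "\<pi> i = j"
      using permutes_image[OF \<pi>(1)] j by (metis imageE)
    with \<pi>(2) j0(2) have "i \<noteq> 4" by blast
    with i(1) have i3: "i \<in> {1..3}" by auto
    have "v x i k \<le> 0" if "k \<in> {1..4}" for k
    proof -
      have "v x i k \<le> v x i j" using \<pi>(3) i3 i(2) that by blast
      also have "v x i j = 0" using \<open>piece x j = {}\<close> by (simp add: v_def)
      finally show ?thesis .
    qed
    then have "(\<Sum>k\<in>{1..4}. v x i k) \<le> 0" by (intro sum_nonpos) auto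
    with total[OF x i3] show False by simp
  qed
  define C where "C j = closure (piece x j)" for j
  have measure_C: "measure \<nu> (C j) = measure \<nu> (piece x j)" if "ac_prob_measure \<nu>" for \<nu> j
    unfolding C_def using that convex_sector open_sector by (rule measure_closure_convex_ac)
  have "envy_free_partition 4 (\<mu>(4 := \<mu>4)) C" if \<mu>4: "ac_prob_measure \<mu>4" for \<mu>4
  proof -
    obtain j0 where j0: "j0 \<in> {1..4}" "\<forall>k\<in>{1..4}. measure \<mu>4 (C k) \<le> measure \<mu>4 (C j0)"
    proof -
      have "Max ((\<lambda>k. measure \<mu>4 (C k)) ` {1..4}) \<in> (\<lambda>k. measure \<mu>4 (C k)) ` {1..4}"
        by (intro Max_in) auto
      then obtain j0 where "j0 \<in> {1..4}"
        "Max ((\<lambda>k. measure \<mu>4 (C k)) ` {1..4}) = measure \<mu>4 (C j0)" by blast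
      then show thesis by (intro that[of j0]) (auto simp flip: \<open>Max _ = _\<close>)
    qed
    obtain \<pi> where \<pi>: "\<pi> permutes {1..4}" "\<pi> 4 = j0"
      "\<forall>i\<in>{1..3}. \<forall>k\<in>{1..4}. v x i k \<le> v x i (\<pi> i)"
      using match[OF j0(1)] by blast
    have "measure ((\<mu>(4 := \<mu>4)) i) (C (\<pi> k)) \<le> measure ((\<mu>(4 := \<mu>4)) i) (C (\<pi> i))"
      if "i \<in> {1..4}" "k \<in> {1..4}" for i k
    proof -
      have \<pi>k: "\<pi> k \<in> {1..4}" using that(2) permutes_in_image[OF \<pi>(1)] by blast
      show ?thesis
      proof (cases "i = 4")
        case True
        with \<pi>k j0(2) \<pi>(2) show ?thesis by simp
      next
        case False
        with that have "i \<in> {1..3}" by auto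
        with False \<pi>k \<pi>(3) ac show ?thesis by (simp add: measure_C v_def)
      qed
    qed
    moreover have "is_partition 4 C"
      unfolding C_def using nonempty by (rule sectors_split_by_two_lines(2))
    ultimately show ?thesis
      unfolding envy_free_partition_def by (intro conjI exI[of _ \<pi>] ballI \<pi>(1))
  qed
  moreover have "split_by_two_lines {z. L_normal x \<bullet> z = L_offset x} {z. M_normal x \<bullet> z = M_offset x} C"
    unfolding C_def using nonempty by (rule sectors_split_by_two_lines(1))
  ultimately show ?thesis by blast
qed

theorem theorem1p3:
  "(\<forall>\<mu> :: nat \<Rightarrow> (real ^ 2) measure.
      (\<forall>i\<in>{1..4}. ac_prob_measure (\<mu> i)) \<longrightarrow>
      (\<exists>L M C. split_by_two_lines L M C \<and> envy_free_partition 4 \<mu> C)) \<and>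
   (\<forall>\<mu> :: nat \<Rightarrow> (real ^ 2) measure.
      (\<forall>i\<in>{1..3}. ac_prob_measure (\<mu> i)) \<longrightarrow>
      (\<exists>L M C. split_by_two_lines L M C \<and>
         (\<forall>\<mu>4. ac_prob_measure \<mu>4 \<longrightarrow> envy_free_partition 4 (\<mu>(4 := \<mu>4)) C)))"
proof (intro conjI allI impI)
  fix \<mu> :: "nat \<Rightarrow> (real ^ 2) measure"
  assume ac: "\<forall>i\<in>{1..4}. ac_prob_measure (\<mu> i)"
  then have "\<forall>i\<in>{1..3}. ac_prob_measure (\<mu> i)" "ac_prob_measure (\<mu> 4)" by auto
  then show "\<exists>L M C. split_by_two_lines L M C \<and> envy_free_partition 4 \<mu> C"
    using secretive_envy_free_lines[of \<mu>] by (metis fun_upd_triv)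
qed (rule secretive_envy_free_lines)

end
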